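(* For every integer $k\ge 4$, there exists a bipartite polyhedral graph with bipartition classes of size $k$ (that is, both classes have exactly $k$ vertices) and with exactly $4k-4$ edges.
   Context: All graphs are finite and simple. A polyhedral graph is the graph (vertices and edges) of a convex three-dimensional polyhedron; equivalently, by Steinitz's theorem, a planar 3-connected graph. *)

theory Defs
  imports "HOL-Analysis.Analysis"
begin

text \<open>A graph is given by its vertex set and its set of edges, an edge being a two-element set
  of vertices; this excludes loops and parallel edges.\<close>

definition simple_graph :: "'a set \<Rightarrow> 'a set set \<Rightarrow> bool" where
  "simple_graph V E \<longleftrightarrow> finite V \<and> (\<forall>e\<in>E. e \<subseteq> V \<and> card e = 2)"

definition graph_isomorphic :: "'a set \<Rightarrow> 'a set set \<Rightarrow> 'b set \<Rightarrow> 'b set set \<Rightarrow> bool" where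
  "graph_isomorphic V E V' E' \<longleftrightarrow>
     (\<exists>f. bij_betw f V V' \<and>
        (\<forall>u\<in>V. \<forall>v\<in>V. {u, v} \<in> E \<longleftrightarrow> {f u, f v} \<in> E'))"

definition skeleton_vertices :: "'a::euclidean_space set \<Rightarrow> 'a set" where
  "skeleton_vertices P = {v. v extreme_point_of P}"

definition skeleton_edges :: "'a::euclidean_space set \<Rightarrow> 'a set set" where
  "skeleton_edges P = {{u, v} | u v. closed_segment u v edge_of P}"

text \<open>The vertices of a polyhedral graph may come from any type: the graph of a polyhedron is
  taken up to isomorphism.\<close>

definition polyhedral_graph :: "'a set \<Rightarrow> 'a set set \<Rightarrow> bool" where
  "polyhedral_graph V E \<longleftrightarrow> simple_graph V E \<and>
     (\<exists>P :: (real ^ 3) set. polytope P \<and> aff_dim P = 3 \<and>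
        graph_isomorphic V E (skeleton_vertices P) (skeleton_edges P))"

definition bipartition :: "'a set \<Rightarrow> 'a set set \<Rightarrow> 'a set \<Rightarrow> 'a set \<Rightarrow> bool" where
  "bipartition V E A B \<longleftrightarrow> A \<union> B = V \<and> A \<inter> B = {} \<and>
     (\<forall>e\<in>E. \<exists>a\<in>A. \<exists>b\<in>B. e = {a, b})"

lemma simple_graph_skeleton:
  assumes "polytope P"
  shows "simple_graph (skeleton_vertices P) (skeleton_edges P)"
proof -
  have fin: "finite (skeleton_vertices P)"
    unfolding skeleton_vertices_def
    by (simp add: assms finite_polyhedron_extreme_points polytope_imp_polyhedron)
  have "e \<subseteq> skeleton_vertices P \<and> card e = 2" if e_in: "e \<in> skeleton_edges P" for e
  proof -
    obtain u v where e: "e = {u, v}" and f: "closed_segment u v edge_of P"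
      using e_in unfolding skeleton_edges_def by blast
    have face: "closed_segment u v face_of P" and dim: "aff_dim (closed_segment u v) = 1"
      using f by (auto simp: edge_of_def)
    have "u \<noteq> v"
      using dim by auto
    moreover have "u extreme_point_of P" "v extreme_point_of P"
      using face extreme_point_of_face[OF face] by (auto simp: extreme_point_of_segment)
    ultimately show ?thesis
      by (auto simp: e skeleton_vertices_def)
  qed
  with fin show ?thesis
    by (simp add: simple_graph_def)
qed

end

theory Submission
  imports Defs
begin

text \<open>The \<open>n\<close>-gonal trapezohedron with \<open>n = k - 1\<close> (the cube for \<open>n = 3\<close>) has \<open>2 * n\<close> vertices on a
  zigzag rim and two apices, the upper one joined to the high and the lower one to the low rim
  vertices. Its \<open>2 * n + 2\<close> vertices and \<open>4 * n\<close> edges form a quadrangulation; one colour class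
  consists of the high rim vertices and the lower apex, the other of the rest. In coordinates, a
  pair of adjacent vertices is cut out by two facet inequalities. Conversely, from a rim vertex
  the whole solid lies in the cone over its three neighbours, so a linear functional that is
  maximal on an edge at that vertex must be maximal at one of these neighbours.\<close>

section \<open>Recognising edges of polytopes\<close>

text \<open>The line through \<open>u\<close> and \<open>v\<close> stays in the hyperplane while the
  hull of the other points stays strictly below it; disjointness of the two makes the segment a
  face.\<close>

lemma closed_segment_edge_of_convex_hull:
  fixes W :: "'a::euclidean_space set"
  assumes W: "finite W" "u \<in> W" "v \<in> W" and "u \<noteq> v"
    and a: "a \<bullet> u = b" "a \<bullet> v = b" "\<And>w. w \<in> W - {u, v} \<Longrightarrow> a \<bullet> w < b"
  shows "closed_segment u v edge_of convex hull W"
proof -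
  have "affine hull {u, v} \<subseteq> {x. a \<bullet> x = b}"
    by (rule hull_minimal) (use a affine_hyperplane in auto)
  moreover have "convex hull (W - {u, v}) \<subseteq> {x. a \<bullet> x < b}"
    by (rule hull_minimal) (use a convex_halfspace_lt in auto)
  ultimately have "affine hull {u, v} \<inter> convex hull (W - {u, v}) = {}"
    by fastforce
  then have "convex hull {u, v} face_of convex hull W"
    by (intro face_of_convex_hulls) (use W in auto)
  then show ?thesis
    using \<open>u \<noteq> v\<close> by (simp add: edge_of_def segment_convex_hull aff_dim_convex_hull aff_dim_2)
qed

lemma extreme_points_of_edge:
  assumes "closed_segment u v edge_of P"
  shows "u extreme_point_of P" "v extreme_point_of P"
  using assms extreme_point_of_face[of "closed_segment u v" P]
  by (auto simp: edge_of_def extreme_point_of_segment)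

text \<open>Faces of polyhedra are exposed. The inequality is strict because an extreme point of
  \<open>P\<close> lying on the segment would be extreme in it, hence one of its ends.\<close>

lemma edge_supporting_hyperplane:
  assumes "polyhedron P" and e: "closed_segment u v edge_of P"
  obtains a b where "a \<bullet> u = b" "a \<bullet> v = b"
    "\<And>x. x extreme_point_of P \<Longrightarrow> x \<noteq> u \<Longrightarrow> x \<noteq> v \<Longrightarrow> a \<bullet> x < b"
proof -
  have f: "closed_segment u v face_of P"
    using e by (simp add: edge_of_def)
  then have "closed_segment u v exposed_face_of P"
    by (simp add: exposed_face_of_polyhedron assms)
  then obtain a b where ab: "P \<subseteq> {x. a \<bullet> x \<le> b}" "closed_segment u v = P \<inter> {x. a \<bullet> x = b}"
    by (auto simp: exposed_face_of_def)
  show thesis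
  proof
    show "a \<bullet> u = b" "a \<bullet> v = b"
      using ab by auto
    fix x assume x: "x extreme_point_of P" "x \<noteq> u" "x \<noteq> v"
    then have "x \<notin> closed_segment u v"
      using extreme_point_of_face[OF f] by (auto simp: extreme_point_of_segment)
    with x ab show "a \<bullet> x < b"
      by (force simp: extreme_point_of_def order_less_le)
  qed
qed

text \<open>A functional that is maximal exactly on the edge is strictly negative on each generator
  \<open>x i - u\<close> with \<open>x i \<noteq> w\<close> but vanishes on \<open>w - u\<close>.\<close>

lemma edge_end_in_generators:
  fixes P :: "'a::euclidean_space set"
  assumes "polyhedron P" and e: "closed_segment u w edge_of P"
    and "finite I" and x: "\<And>i. i \<in> I \<Longrightarrow> x i extreme_point_of P" "\<And>i. i \<in> I \<Longrightarrow> x i \<noteq> u"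
    and c: "\<And>i. i \<in> I \<Longrightarrow> 0 \<le> c i"
    and w: "w - u = (\<Sum>i\<in>I. c i *\<^sub>R (x i - u))"
  shows "\<exists>i\<in>I. x i = w"
proof (rule ccontr)
  assume no: "\<not> ?thesis"
  obtain a b where ab: "a \<bullet> u = b" "a \<bullet> w = b"
    "\<And>x. x extreme_point_of P \<Longrightarrow> x \<noteq> u \<Longrightarrow> x \<noteq> w \<Longrightarrow> a \<bullet> x < b"
    using edge_supporting_hyperplane[OF assms(1) e] by blast
  have neg: "a \<bullet> (x i - u) < 0" if "i \<in> I" for i
    using ab x that no by (auto simp: inner_diff_right)
  have "(\<Sum>i\<in>I. c i * - (a \<bullet> (x i - u))) = - (a \<bullet> (w - u))"
    by (simp add: w inner_sum_right sum_negf)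
  also have "\<dots> = 0"
    using ab by (simp add: inner_diff_right)
  finally have "\<forall>i\<in>I. c i * - (a \<bullet> (x i - u)) = 0"
    using c neg \<open>finite I\<close> by (subst (asm) sum_nonneg_eq_0_iff) (auto simp: mult_le_0_iff less_imp_le)
  then have "\<forall>i\<in>I. c i = 0"
    using neg by fastforce
  then have "w = u"
    using w by simp
  then show False
    using e by (simp add: edge_of_def)
qed

section \<open>The trapezohedron\<close>

locale trapezohedron =
  fixes n :: nat
  assumes n_ge_3: "3 \<le> n"
begin

text \<open>Integer indices spare the neighbours \<open>j - 1\<close> and \<open>j + 1\<close> any
  wrap-around; a full turn is \<open>2 * n\<close> steps.\<close>

definition angle :: "int \<Rightarrow> real" where
  "angle j = of_int j * (pi / real n)"

definition c :: real where
  "c = cos (pi / real n)"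

definition sg :: "int \<Rightarrow> real" where
  "sg j = (if even j then 1 else - 1)"

text \<open>The heights \<open>1 - c\<close> and \<open>1 + c\<close> make each kite \<open>apex (- sg j)\<close>, \<open>rim (j - 1)\<close>, \<open>rim j\<close>,
  \<open>rim (j + 1)\<close> planar, namely contained in \<open>{x. slack j x = 0}\<close>.\<close>

definition rim :: "int \<Rightarrow> real ^ 3" where
  "rim j = vector [cos (angle j), sin (angle j), sg j * (1 - c)]"

definition apex :: "real \<Rightarrow> real ^ 3" where
  "apex s = vector [0, 0, s * (1 + c)]"

text \<open>Outward normal of the kite centred at \<open>rim j\<close>, scaled so that every facet
  plane has the same offset \<open>1 + c\<close>.\<close>

definition normal :: "int \<Rightarrow> real ^ 3" where
  "normal j = vector [2 * cos (angle j), 2 * sin (angle j), - sg j]"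

definition slack :: "int \<Rightarrow> real ^ 3 \<Rightarrow> real" where
  "slack j x = 1 + c - normal j \<bullet> x"

definition corners :: "(real ^ 3) set" where
  "corners = range rim \<union> {apex 1, apex (- 1)}"

definition solid :: "(real ^ 3) set" where
  "solid = convex hull corners"

section \<open>Angles and cosines along the rim\<close>

lemma c_bounds: "0 < c" "c < 1"
proof -
  have "cos (pi / 2) < c" "c < cos 0"
    unfolding c_def using n_ge_3 by (intro cos_monotone_0_pi; simp add: field_simps)+
  then show "0 < c" "c < 1" by simp_all
qed

lemma sg_simps [simp]: "sg (j + 1) = - sg j" "sg (j - 1) = - sg j" "sg j * sg j = 1"
  by (simp_all add: sg_def)

lemma angle_add: "angle (i + j) = angle i + angle j"
  and angle_diff: "angle (i - j) = angle i - angle j"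
  by (simp_all add: angle_def distrib_right left_diff_distrib diff_divide_distrib add_divide_distrib)

lemma angle_period: "angle (2 * int n * k) = 2 * pi * of_int k"
  using n_ge_3 by (simp add: angle_def)

lemma angle_1: "angle 1 = pi / real n"
  by (simp add: angle_def)

text \<open>Cosine is even and periodic, so an index difference folds into the range from
  \<open>0\<close> to \<open>n\<close>, where cosine is strictly decreasing.\<close>

lemma cos_angle_reduce:
  obtains k m :: int where "0 \<le> m" "m \<le> int n" "d = 2 * int n * k + m \<or> d = 2 * int n * k - m"
    "cos (angle d) = cos (angle m)"
proof -
  define r where "r = d mod (2 * int n)"
  define q where "q = d div (2 * int n)"
  have d: "d = 2 * int n * q + r" and r: "0 \<le> r" "r < 2 * int n"
    using n_ge_3 by (simp_all add: q_def r_def)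
  obtain k m where km: "0 \<le> m" "m \<le> int n" "d = 2 * int n * k + m \<or> d = 2 * int n * k - m"
  proof (cases "r \<le> int n")
    case True
    then show ?thesis using that[of r q] d r by auto
  next
    \<comment> \<open>A remainder in the second half turn is reflected about the next full
      turn.\<close>
    case False
    then show ?thesis using that[of "2 * int n - r" "q + 1"] d r by (auto simp: algebra_simps)
  qed
  then have "angle d = 2 * pi * of_int k + angle m \<or> angle d = 2 * pi * of_int k - angle m"
    by (auto simp: angle_add angle_diff angle_period)
  then have "cos (angle d) = cos (angle m)"
    by (auto simp: cos_add cos_diff)
  with km that show thesis by blast
qed

lemma rim_periodic: "rim (j + 2 * int n * k) = rim j"
  by (simp add: rim_def sg_def angle_add angle_period cos_add sin_add)

section \<open>Slacks of the corners\<close>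

text \<open>The heights contribute \<open>1 - c\<close> with the sign of the parity of
  \<open>i - j\<close>, and \<open>1 + c\<close> plus or minus \<open>1 - c\<close> is
  \<open>2\<close> or \<open>2 * c\<close>.\<close>

lemma slack_rim:
  "slack j (rim i) = (if even (i - j) then 2 else 2 * c) - 2 * cos (angle (i - j))"
  by (auto simp: slack_def rim_def normal_def sg_def inner_vec_def sum_3 angle_diff cos_diff
      algebra_simps)

lemma slack_apex: "slack j (apex s) = (1 + s * sg j) * (1 + c)"
  by (simp add: slack_def apex_def normal_def inner_vec_def sum_3 algebra_simps)

text \<open>At folded distance \<open>0\<close> or \<open>1\<close> the two terms of
  \<open>slack_rim\<close> cancel; at larger distance the cosine is below \<open>c\<close>, hence
  below both possible first terms.\<close>

lemma
  shows slack_rim_nonneg: "0 \<le> slack j (rim i)"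
    and slack_rim_eq_0: "slack j (rim i) = 0 \<Longrightarrow> \<exists>k. \<exists>e\<in>{- 1, 0, 1}. i = j + 2 * int n * k + e"
proof -
  obtain k m :: int where m: "0 \<le> m" "m \<le> int n"
    and km: "i - j = 2 * int n * k + m \<or> i - j = 2 * int n * k - m"
    and cos: "cos (angle (i - j)) = cos (angle m)"
    using cos_angle_reduce by metis
  \<comment> \<open>Folding shifts by multiples of the even period and may change a sign; both
    preserve parity.\<close>
  have par: "even (i - j) \<longleftrightarrow> even m"
    using km by (metis dvd_diff_right_iff dvd_add_right_iff even_mult_iff even_numeral)
  have eq: "slack j (rim i) = (if even m then 2 else 2 * c) - 2 * cos (angle m)"
    using slack_rim cos par by simp
  have less: "cos (angle m) < c" if "1 < m"
    unfolding c_def angle_def using that m n_ge_3 by (intro cos_monotone_0_pi) (auto simp: field_simps)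
  have small: "m = 0 \<or> m = 1 \<or> 1 < m" using m by auto
  have c1: "cos (angle 1) = c" by (simp add: c_def angle_def)
  show "0 \<le> slack j (rim i)"
    using small eq less c1 c_bounds by (auto simp: angle_def)
  show "\<exists>k. \<exists>e\<in>{- 1, 0, 1}. i = j + 2 * int n * k + e" if "slack j (rim i) = 0"
  proof -
    have "\<not> 1 < m"
      using that eq less c_bounds by (auto split: if_splits)
    then have "m = 0 \<or> m = 1" using small by auto
    then show ?thesis using km
      by (intro exI[of _ k]) auto
  qed
qed

lemma slack_rim_near [simp]:
  "slack j (rim j) = 0" "slack j (rim (j + 1)) = 0" "slack j (rim (j - 1)) = 0"
  by (simp_all add: slack_rim angle_def c_def)

lemma corner_cases:
  assumes "x \<in> corners"
  obtains i where "x = rim i" | i where "x = apex (sg i)"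
  using assms unfolding corners_def by (metis Un_iff imageE insertE singletonD sg_def even_zero odd_one)

lemma corners_intros [simp]: "rim j \<in> corners" "apex (sg j) \<in> corners"
  by (auto simp: corners_def sg_def)

lemma slack_nonneg: "x \<in> corners \<Longrightarrow> 0 \<le> slack j x"
  using slack_rim_nonneg c_bounds by (auto simp: corners_def slack_apex sg_def)

text \<open>As \<open>n\<close> is at least 3, the period \<open>2 * n\<close> is at least 6, so
  indices congruent modulo it and less than 6 apart coincide.\<close>

lemma multiple_small:
  assumes "int n * 2 * k = e" "\<bar>e\<bar> < 6"
  shows "e = 0"
proof (rule ccontr)
  assume "e \<noteq> 0"
  then have "k \<noteq> 0" using assms by auto
  then have "int n * 2 * 1 \<le> int n * 2 * \<bar>k\<bar>"
    by (intro mult_left_mono) auto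
  also have "\<dots> = \<bar>e\<bar>" using assms(1) by (auto simp: abs_mult)
  finally show False using assms n_ge_3 by linarith
qed

text \<open>The centres differ by at most 2 and each offset adds at most 1, giving a total of at
  most 4, below the period.\<close>

lemma slack_rim_eq_0_both:
  assumes "slack j (rim i) = 0" "slack k (rim i) = 0" "\<bar>j - k\<bar> \<le> 2"
  shows "\<exists>l. \<bar>l - j\<bar> \<le> 1 \<and> \<bar>l - k\<bar> \<le> 1 \<and> rim i = rim l"
proof -
  obtain p e where p: "e \<in> {- 1, 0, 1}" "i = j + 2 * int n * p + e"
    using slack_rim_eq_0[OF assms(1)] by blast
  obtain q f where q: "f \<in> {- 1, 0, 1}" "i = k + 2 * int n * q + f"
    using slack_rim_eq_0[OF assms(2)] by blast
  have "int n * 2 * (p - q) = k - j + f - e"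
    using p q by (simp add: algebra_simps)
  moreover have "\<bar>k - j + f - e\<bar> < 6"
    using p(1) q(1) assms(3) by auto
  ultimately have "k - j + f - e = 0"
    by (rule multiple_small)
  moreover have "rim i = rim (j + e)"
    using rim_periodic[of "j + e" p] p(2) by (simp add: algebra_simps)
  ultimately show ?thesis
    using p(1) q(1) by (intro exI[of _ "j + e"]) auto
qed

text \<open>\<open>rim j\<close> lies on the kites centred at \<open>j - 1\<close>, \<open>j\<close>
  and \<open>j + 1\<close>; modulo the period, their three index windows meet only in
  \<open>j\<close>.\<close>

lemma rim_eq_iff: "rim i = rim j \<longleftrightarrow> (\<exists>k. i = j + 2 * int n * k)"
proof
  assume eq: "rim i = rim j"
  obtain k e where k: "e \<in> {- 1, 0, 1}" "i = j + 2 * int n * k + e"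
    using slack_rim_eq_0[of j i] eq by force
  obtain k' e' where k': "e' \<in> {- 1, 0, 1}" "i = j + 1 + 2 * int n * k' + e'"
    using slack_rim_eq_0[of "j + 1" i] slack_rim_near(3)[of "j + 1"] eq by force
  obtain k'' e'' where k'': "e'' \<in> {- 1, 0, 1}" "i = j - 1 + 2 * int n * k'' + e''"
    using slack_rim_eq_0[of "j - 1" i] slack_rim_near(2)[of "j - 1"] eq by force
  have "int n * 2 * (k - k') = 1 + e' - e" "int n * 2 * (k - k'') = - 1 + e'' - e"
    using k k' k'' by (simp_all add: algebra_simps)
  moreover have "\<bar>1 + e' - e\<bar> < 6" "\<bar>- 1 + e'' - e\<bar> < 6"
    using k(1) k'(1) k''(1) by auto
  ultimately have "1 + e' - e = 0" "- 1 + e'' - e = 0"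
    using multiple_small by metis+
  then show "\<exists>k. i = j + 2 * int n * k"
    using k k' k'' by auto
qed (auto simp: rim_periodic)

lemma rim_neq_apex [simp]: "rim i \<noteq> apex s"
proof
  assume "rim i = apex s"
  then have "cos (angle i) = 0" "sin (angle i) = 0"
    by (simp_all add: rim_def apex_def vec_eq_iff forall_3)
  then show False
    using sin_cos_squared_add[of "angle i"] by simp
qed

lemma apex_eq_iff [simp]: "apex s = apex t \<longleftrightarrow> s = t"
  using c_bounds by (auto simp: apex_def vec_eq_iff forall_3)

lemma rim_succ_neq: "rim j \<noteq> rim (j + 1)"
proof
  assume "rim j = rim (j + 1)"
  then obtain k where "j = j + 1 + 2 * int n * k" by (auto simp: rim_eq_iff)
  then have "int n * 2 * k = - 1" by simp
  then show False using multiple_small by fastforce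
qed

lemma range_rim: "range rim = (\<lambda>i. rim (int i)) ` {..<2 * n}"
proof -
  have "rim j \<in> (\<lambda>i. rim (int i)) ` {..<2 * n}" for j
  proof (rule image_eqI)
    show "rim j = rim (int (nat (j mod (2 * int n))))"
      using rim_periodic[of "j mod (2 * int n)" "j div (2 * int n)"] n_ge_3
      by simp
    show "nat (j mod (2 * int n)) \<in> {..<2 * n}"
      using n_ge_3 by (simp add: nat_less_iff)
  qed
  then show ?thesis by auto
qed

lemma finite_corners: "finite corners"
  by (simp add: corners_def range_rim)

lemma polytope_solid: "polytope solid"
  unfolding solid_def by (rule polytope_convex_hull[OF finite_corners])

section \<open>Edges that are present\<close>

text \<open>The sum of the two normals attains its maximum over the corners exactly where both
  slacks vanish.\<close>

lemma edge_of_two_facets: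
  assumes "u \<in> corners" "v \<in> corners" "u \<noteq> v"
    and "slack j u = 0" "slack j v = 0" "slack k u = 0" "slack k v = 0"
    and only: "\<And>x. x \<in> corners \<Longrightarrow> slack j x = 0 \<Longrightarrow> slack k x = 0 \<Longrightarrow> x = u \<or> x = v"
  shows "closed_segment u v edge_of solid"
  unfolding solid_def
proof (rule closed_segment_edge_of_convex_hull[where a = "normal j + normal k" and b = "2 * (1 + c)"])
  have *: "(normal j + normal k) \<bullet> x = 2 * (1 + c) - slack j x - slack k x" for x
    by (simp add: slack_def inner_add_left)
  show "(normal j + normal k) \<bullet> u = 2 * (1 + c)" "(normal j + normal k) \<bullet> v = 2 * (1 + c)"
    using assms by (simp_all add: *)
  fix w assume "w \<in> corners - {u, v}"
  then show "(normal j + normal k) \<bullet> w < 2 * (1 + c)"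
    using only[of w] slack_nonneg[of w j] slack_nonneg[of w k] by (fastforce simp: *)
qed (use assms finite_corners in auto)

lemma edge_rim_rim: "closed_segment (rim j) (rim (j + 1)) edge_of solid"
proof (rule edge_of_two_facets[of _ _ j "j + 1"])
  fix x assume x: "x \<in> corners" "slack j x = 0" "slack (j + 1) x = 0"
  then show "x = rim j \<or> x = rim (j + 1)"
  proof (cases rule: corner_cases)
    case (1 i)
    then obtain l where l: "\<bar>l - j\<bar> \<le> 1" "\<bar>l - (j + 1)\<bar> \<le> 1" "x = rim l"
      using slack_rim_eq_0_both[of j i "j + 1"] x by auto
    then have "l = j \<or> l = j + 1" by linarith
    then show ?thesis using l by auto
  next
    \<comment> \<open>Consecutive kites have opposite apices, so no apex lies on both.\<close>
    case (2 i)
    then show ?thesis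
      using x c_bounds by (simp add: slack_apex)
  qed
qed (use slack_rim_near(3)[of "j + 1"] rim_succ_neq in auto)

text \<open>The kites at \<open>j - 1\<close> and \<open>j + 1\<close> share the apex
  \<open>apex (sg j)\<close>, and \<open>j\<close> is the only index within 1 of both
  centres.\<close>

lemma edge_rim_apex: "closed_segment (rim j) (apex (sg j)) edge_of solid"
proof (rule edge_of_two_facets[of _ _ "j - 1" "j + 1"])
  fix x assume x: "x \<in> corners" "slack (j - 1) x = 0" "slack (j + 1) x = 0"
  then show "x = rim j \<or> x = apex (sg j)"
  proof (cases rule: corner_cases)
    case (1 i)
    then obtain l where l: "\<bar>l - (j - 1)\<bar> \<le> 1" "\<bar>l - (j + 1)\<bar> \<le> 1" "x = rim l"
      using slack_rim_eq_0_both[of "j - 1" i "j + 1"] x by auto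
    then have "l = j" by linarith
    then show ?thesis using l by auto
  next
    case (2 i)
    then show ?thesis
      using x c_bounds by (auto simp: slack_apex sg_def split: if_splits)
  qed
qed (use slack_rim_near(3)[of "j + 1"] slack_rim_near(2)[of "j - 1"] in \<open>auto simp: slack_apex\<close>)

text \<open>Every corner is an end of some edge from a rim vertex to an apex, and ends of edges are
  extreme.\<close>

lemma extreme_point_of_solid_iff: "x extreme_point_of solid \<longleftrightarrow> x \<in> corners"
proof
  show "x extreme_point_of solid" if "x \<in> corners"
    using that
    by (cases rule: corner_cases) (use extreme_points_of_edge[OF edge_rim_apex] in auto)
qed (simp add: solid_def extreme_point_of_convex_hull)

section \<open>Neighbours of a rim vertex\<close>

text \<open>The cone at \<open>rim j\<close> is simplicial; the coefficient of each of the three neighbours is the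
  slack of the facet opposite to it, normalised.\<close>

lemma cone_identity:
  fixes C S c s x y z g :: real
  assumes "C * C + S * S = 1" "c * c + s * s = 1"
  shows "4 * (1 - c) * (1 + c) * (x - C) =
      2 * (1 - c) * (1 + c - 2 * C * x - 2 * S * y + g * z) * (0 - C)
      + (1 + c - 2 * (C * c - S * s) * x - 2 * (S * c + C * s) * y - g * z) * (C * c + S * s - C)
      + (1 + c - 2 * (C * c + S * s) * x - 2 * (S * c - C * s) * y - g * z) * (C * c - S * s - C)"
    and "4 * (1 - c) * (1 + c) * (y - S) =
      2 * (1 - c) * (1 + c - 2 * C * x - 2 * S * y + g * z) * (0 - S)
      + (1 + c - 2 * (C * c - S * s) * x - 2 * (S * c + C * s) * y - g * z) * (S * c - C * s - S)
      + (1 + c - 2 * (C * c + S * s) * x - 2 * (S * c - C * s) * y - g * z) * (S * c + C * s - S)"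
  using assms by algebra+

text \<open>The denominators are the opposite slacks at the neighbours: \<open>slack j\<close> is
  \<open>2 * (1 + c)\<close> at \<open>apex (sg j)\<close>, and \<open>slack (j + 1)\<close> at
  \<open>rim (j - 1)\<close> is 2 minus twice the cosine of the doubled angle, that is
  \<open>4 * (1 - c\<^sup>2)\<close>.\<close>

lemma rim_cone:
  "w - rim j = (slack j w / (2 * (1 + c))) *\<^sub>R (apex (sg j) - rim j)
     + (slack (j + 1) w / (4 * (1 - c\<^sup>2))) *\<^sub>R (rim (j - 1) - rim j)
     + (slack (j - 1) w / (4 * (1 - c\<^sup>2))) *\<^sub>R (rim (j + 1) - rim j)"
proof -
  define C S s where "C = cos (angle j)" and "S = sin (angle j)" and "s = sin (pi / real n)"
  have trig: "cos (angle (j + 1)) = C * c - S * s" "sin (angle (j + 1)) = S * c + C * s"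
      "cos (angle (j - 1)) = C * c + S * s" "sin (angle (j - 1)) = S * c - C * s"
    by (simp_all add: C_def S_def s_def c_def angle_add angle_diff angle_1 cos_add sin_add
        cos_diff sin_diff)
  have rel: "C * C + S * S = 1" "c * c + s * s = 1" "sg j * sg j = 1"
    using sin_cos_squared_add[of "angle j"] sin_cos_squared_add[of "pi / real n"]
    by (simp_all add: C_def S_def s_def c_def power2_eq_square)
  \<comment> \<open>Clearing denominators turns each coordinate into a polynomial identity modulo
    the relations \<open>rel\<close>.\<close>
  have clear: "x = p / (2 * (1 + c)) * P + q / (4 * (1 - c\<^sup>2)) * Q + r / (4 * (1 - c\<^sup>2)) * R"
    if "4 * (1 - c) * (1 + c) * x = 2 * (1 - c) * p * P + q * Q + r * R" for x p q r P Q R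
  proof -
    have D: "1 - c\<^sup>2 = (1 - c) * (1 + c)" by (simp add: power2_eq_square algebra_simps)
    have "x = (4 * (1 - c) * (1 + c) * x) / (4 * ((1 - c) * (1 + c)))"
      using c_bounds by simp
    also have "\<dots> = (2 * (1 - c) * p * P + q * Q + r * R) / (4 * ((1 - c) * (1 + c)))"
      unfolding that ..
    also have "\<dots> = p / (2 * (1 + c)) * P + q / (4 * ((1 - c) * (1 + c))) * Q + r / (4 * ((1 - c) * (1 + c))) * R"
    proof -
      have "2 * a * p * P / (4 * (a * b)) = p / (2 * b) * P" if "a \<noteq> 0" for a b
        using that by simp
      from this[of "1 - c" "1 + c"] show ?thesis
        using c_bounds by (simp only: add_divide_distrib) simp
    qed
    finally show ?thesis unfolding D .
  qed
  have slack: "slack j w = 1 + c - 2 * C * w $ 1 - 2 * S * w $ 2 + sg j * w $ 3"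
    "slack (j + 1) w = 1 + c - 2 * (C * c - S * s) * w $ 1 - 2 * (S * c + C * s) * w $ 2 - sg j * w $ 3"
    "slack (j - 1) w = 1 + c - 2 * (C * c + S * s) * w $ 1 - 2 * (S * c - C * s) * w $ 2 - sg j * w $ 3"
    by (simp_all add: slack_def normal_def inner_vec_def sum_3 trig C_def[symmetric] S_def[symmetric])
  show ?thesis
    unfolding vec_eq_iff forall_3 vector_add_component vector_minus_component vector_scaleR_component
      real_scaleR_def
  proof (intro conjI clear)
    show "4 * (1 - c) * (1 + c) * (w $ 1 - rim j $ 1) =
        2 * (1 - c) * slack j w * (apex (sg j) $ 1 - rim j $ 1)
        + slack (j + 1) w * (rim (j - 1) $ 1 - rim j $ 1)
        + slack (j - 1) w * (rim (j + 1) $ 1 - rim j $ 1)"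
      unfolding slack rim_def apex_def trig vector_3 C_def[symmetric] S_def[symmetric]
      by (rule cone_identity[OF rel(1,2)])
    show "4 * (1 - c) * (1 + c) * (w $ 2 - rim j $ 2) =
        2 * (1 - c) * slack j w * (apex (sg j) $ 2 - rim j $ 2)
        + slack (j + 1) w * (rim (j - 1) $ 2 - rim j $ 2)
        + slack (j - 1) w * (rim (j + 1) $ 2 - rim j $ 2)"
      unfolding slack rim_def apex_def trig vector_3 C_def[symmetric] S_def[symmetric]
      by (rule cone_identity[OF rel(1,2)])
    show "4 * (1 - c) * (1 + c) * (w $ 3 - rim j $ 3) =
        2 * (1 - c) * slack j w * (apex (sg j) $ 3 - rim j $ 3)
        + slack (j + 1) w * (rim (j - 1) $ 3 - rim j $ 3)
        + slack (j - 1) w * (rim (j + 1) $ 3 - rim j $ 3)"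
      unfolding slack rim_def apex_def trig vector_3 sg_simps C_def[symmetric] S_def[symmetric]
      using rel by algebra
  qed
qed

text \<open>The other end is a corner, so its slacks are nonnegative and \<open>rim_cone\<close>
  supplies the conic combination required by \<open>edge_end_in_generators\<close>.\<close>

lemma edge_from_rim:
  assumes e: "closed_segment (rim j) w edge_of solid"
  shows "w \<in> {apex (sg j), rim (j - 1), rim (j + 1)}"
proof -
  \<comment> \<open>Index \<open>0\<close> stands for the apex and index \<open>1\<close> or
    \<open>- 1\<close> for a rim neighbour, whose opposite facet is \<open>j - i\<close>.\<close>
  define x where "x i = (if i = 0 then apex (sg j) else rim (j + i))" for i :: int
  define d where "d i = (if i = 0 then slack j w / (2 * (1 + c)) else slack (j - i) w / (4 * (1 - c\<^sup>2)))"
    for i :: int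
  have w: "w \<in> corners"
    using extreme_points_of_edge[OF e] extreme_point_of_solid_iff by simp
  have pos: "0 < 1 + c" "0 < 1 - c\<^sup>2"
    using c_bounds power_strict_mono[of c 1 2] by simp_all
  have "\<exists>i\<in>{- 1, 0, 1}. x i = w"
  proof (rule edge_end_in_generators[OF _ e])
    show "polyhedron solid"
      by (simp add: polytope_solid polytope_imp_polyhedron)
    show "x i extreme_point_of solid" for i
      by (simp add: extreme_point_of_solid_iff x_def)
    show "x i \<noteq> rim j" if "i \<in> {- 1, 0, 1}" for i
      using that rim_succ_neq[of j] rim_succ_neq[of "j - 1"] rim_neq_apex[of j "sg j"]
      by (auto simp: x_def simp del: rim_neq_apex)
    show "0 \<le> d i" for i
      using slack_nonneg[OF w] pos by (simp add: d_def)
    show "w - rim j = (\<Sum>i\<in>{- 1, 0, 1}. d i *\<^sub>R (x i - rim j))"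
      using rim_cone[of w j] by (simp add: d_def x_def)
  qed simp
  then show ?thesis
    by (auto simp: x_def)
qed

text \<open>A supporting functional equal at the two opposite apices is horizontal with value 0
  there; it cannot be negative at both \<open>rim 0\<close> and \<open>rim (int n)\<close>, whose
  horizontal parts are opposite.\<close>

lemma no_edge_apex_apex:
  assumes "s \<noteq> 0"
  shows "\<not> closed_segment (apex s) (apex (- s)) edge_of solid"
proof
  assume e: "closed_segment (apex s) (apex (- s)) edge_of solid"
  obtain a b where ab: "a \<bullet> apex s = b" "a \<bullet> apex (- s) = b"
    "\<And>x. x extreme_point_of solid \<Longrightarrow> x \<noteq> apex s \<Longrightarrow> x \<noteq> apex (- s) \<Longrightarrow> a \<bullet> x < b"
    using edge_supporting_hyperplane[OF polytope_imp_polyhedron[OF polytope_solid] e] by metis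
  have "a $ 3 * (s * (1 + c)) = b" "- (a $ 3 * (s * (1 + c))) = b"
    using ab(1,2) by (simp_all add: apex_def inner_vec_def sum_3)
  then have "a $ 3 * (s * (1 + c)) = 0" "b = 0" by linarith+
  then have a3: "a $ 3 = 0" "b = 0"
    using assms c_bounds by auto
  have "a \<bullet> rim 0 < 0" "a \<bullet> rim (int n) < 0"
    using ab(3) a3 by (simp_all add: extreme_point_of_solid_iff)
  moreover have "angle (int n) = pi"
    using n_ge_3 by (simp add: angle_def)
  ultimately show False
    using a3 by (simp add: rim_def inner_vec_def sum_3 angle_def)
qed

section \<open>The skeleton and dimension of the solid\<close>

lemma skeleton_vertices_solid: "skeleton_vertices solid = corners"
  by (simp add: skeleton_vertices_def extreme_point_of_solid_iff)

lemma skeleton_edges_solid: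
  "skeleton_edges solid = range (\<lambda>j. {rim j, rim (j + 1)}) \<union> range (\<lambda>j. {rim j, apex (sg j)})"
    (is "_ = ?R")
proof
  have from_rim: "{rim j, w} \<in> ?R" if "closed_segment (rim j) w edge_of solid" for j w
  proof -
    \<comment> \<open>The edge to the predecessor is listed under the index
      \<open>j - 1\<close>.\<close>
    have "{rim (j - 1), rim (j - 1 + 1)} \<in> ?R" by blast
    then show ?thesis
      using edge_from_rim[OF that] by (auto simp: insert_commute)
  qed
  show "skeleton_edges solid \<subseteq> ?R"
  proof
    fix e assume "e \<in> skeleton_edges solid"
    then obtain u v where e: "e = {u, v}" and uv: "closed_segment u v edge_of solid"
      by (auto simp: skeleton_edges_def)
    then have vu: "closed_segment v u edge_of solid"
      by (simp add: closed_segment_commute)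
    have "u \<in> corners" "v \<in> corners" "u \<noteq> v"
      using extreme_points_of_edge[OF uv] uv by (auto simp: extreme_point_of_solid_iff edge_of_def)
    then consider i where "u = rim i" | i where "v = rim i"
      | "u = apex 1" "v = apex (- 1)" | "u = apex (- 1)" "v = apex 1"
      by (auto simp: corners_def)
    then show "e \<in> ?R"
    proof cases
      case 1
      then show ?thesis using from_rim uv e by auto
    next
      case 2
      then have "{v, u} \<in> ?R"
        using from_rim[of i u] vu by simp
      then show ?thesis
        unfolding e insert_commute[of u v] .
    qed (use no_edge_apex_apex[of 1] uv vu in auto)
  qed
  show "?R \<subseteq> skeleton_edges solid"
    using edge_rim_rim edge_rim_apex by (auto simp: skeleton_edges_def)
qed

text \<open>No plane contains all corners: the apices force offset and height coefficient to vanish,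
  then \<open>rim 0\<close> and \<open>rim 1\<close> kill the horizontal ones.\<close>

lemma aff_dim_solid: "aff_dim solid = 3"
proof -
  have "interior solid \<noteq> {}"
  proof
    assume "interior solid = {}"
    then obtain a b where "a \<noteq> 0" "solid \<subseteq> {x. a \<bullet> x = b}"
      using empty_interior_subset_hyperplane[of solid] by (auto simp: solid_def)
    have *: "a \<bullet> x = b" if "x \<in> corners" for x
      using that \<open>solid \<subseteq> {x. a \<bullet> x = b}\<close> hull_subset[of corners convex] by (auto simp: solid_def)
    have "a $ 3 * (1 + c) = b"
      using *[of "apex 1"] by (simp add: corners_def apex_def inner_vec_def sum_3)
    moreover have "a $ 3 * (1 + c) = - b"
      using *[of "apex (- 1)"] by (simp add: corners_def apex_def inner_vec_def sum_3 algebra_simps)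
    ultimately have "a $ 3 * (1 + c) = 0" "b = 0" by linarith+
    then have a3: "a $ 3 = 0" "b = 0"
      using c_bounds by auto
    have a1: "a $ 1 = 0"
      using *[OF corners_intros(1)[of 0]] a3 by (simp add: rim_def inner_vec_def sum_3 angle_def)
    have "0 < sin (angle 1)"
      unfolding angle_def using n_ge_3 by (intro sin_gt_zero) (auto simp: field_simps)
    then have "a $ 2 = 0"
      using *[OF corners_intros(1)[of 1]] a3 a1 by (simp add: rim_def inner_vec_def sum_3)
    with a1 a3 \<open>a \<noteq> 0\<close> show False
      by (simp add: vec_eq_iff forall_3)
  qed
  then show ?thesis
    by (simp add: aff_dim_nonempty_interior)
qed

section \<open>The graph of the trapezohedron\<close>

definition succ :: "nat \<Rightarrow> nat" where
  "succ i = (if i = 2 * n - 1 then 0 else i + 1)"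

definition pole :: "nat \<Rightarrow> nat" where
  "pole i = (if even i then 2 * n else 2 * n + 1)"

text \<open>By parity, \<open>2 * n\<close> goes to the upper apex and \<open>2 * n + 1\<close> to
  the lower one.\<close>

definition place :: "nat \<Rightarrow> real ^ 3" where
  "place i = (if i < 2 * n then rim (int i) else apex (sg (int i)))"

definition verts :: "nat set" where
  "verts = {..<2 * n + 2}"

definition edges :: "nat set set" where
  "edges = (\<lambda>i. {i, succ i}) ` {..<2 * n} \<union> (\<lambda>i. {i, pole i}) ` {..<2 * n}"

lemma succ_lt: "i < 2 * n \<Longrightarrow> succ i < 2 * n"
  by (auto simp: succ_def)

lemma succ_neq: "succ i \<noteq> i"
  using n_ge_3 by (auto simp: succ_def)

lemma place_rim: "i < 2 * n \<Longrightarrow> place i = rim (int i)"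
  by (simp add: place_def)

lemma edges_subset: "e \<in> edges \<Longrightarrow> e \<subseteq> verts"
  using succ_lt by (force simp: edges_def verts_def pole_def)

lemma place_succ: "i < 2 * n \<Longrightarrow> place (succ i) = rim (int i + 1)"
  using rim_periodic[of 0 1] n_ge_3
  by (auto simp: place_def succ_def of_nat_diff algebra_simps)

lemma place_pole: "place (pole i) = apex (sg (int i))"
  by (auto simp: place_def pole_def sg_def)

lemma verts_split: "verts = {..<2 * n} \<union> {2 * n, 2 * n + 1}"
  by (auto simp: verts_def)

lemma place_verts: "place ` verts = corners"
  unfolding verts_split image_Un corners_def range_rim by (auto simp: place_def sg_def)

lemma inj_on_place: "inj_on place verts"
proof -
  have "i = j" if "i < 2 * n" "j < 2 * n" "rim (int i) = rim (int j)" for i j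
  proof -
    obtain k where "int i = int j + 2 * int n * k"
      using \<open>rim (int i) = rim (int j)\<close> by (auto simp: rim_eq_iff)
    then have "int i mod (2 * int n) = int j mod (2 * int n)" by simp
    then show ?thesis using that by simp
  qed
  moreover have "place (2 * n) \<noteq> place (2 * n + 1)"
    by (simp add: place_def sg_def)
  ultimately show ?thesis
    unfolding inj_on_def verts_split
    by (auto simp: place_def dest: sym[of "apex _" "rim _"])
qed

text \<open>Integer indices reduce modulo \<open>2 * n\<close>; this period is even, so
  \<open>sg\<close> and thus the apex are unchanged.\<close>

lemma place_edges: "(`) place ` edges = skeleton_edges solid"
proof -
  have 1: "range (\<lambda>j. {rim j, rim (j + 1)}) = (\<lambda>i. {rim (int i), rim (int i + 1)}) ` {..<2 * n}"
    and 2: "range (\<lambda>j. {rim j, apex (sg j)}) = (\<lambda>i. {rim (int i), apex (sg (int i))}) ` {..<2 * n}"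
  proof -
    have red: "\<exists>i<2 * n. rim j = rim (int i) \<and> rim (j + 1) = rim (int i + 1) \<and> sg j = sg (int i)"
      for j
    proof -
      define i where "i = nat (j mod (2 * int n))"
      have "i < 2 * n" and j: "j = int i + 2 * int n * (j div (2 * int n))"
        using n_ge_3 by (auto simp: i_def nat_less_iff)
      moreover have "rim j = rim (int i)" "rim (j + 1) = rim (int i + 1)"
        using rim_periodic[of "int i" "j div (2 * int n)"]
          rim_periodic[of "int i + 1" "j div (2 * int n)"] j by (simp_all add: ac_simps)
      moreover have "sg j = sg (int i)"
        by (subst j) (simp add: sg_def)
      ultimately show ?thesis by blast
    qed
    show "range (\<lambda>j. {rim j, rim (j + 1)}) = (\<lambda>i. {rim (int i), rim (int i + 1)}) ` {..<2 * n}"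
    proof (intro equalityI subsetI)
      fix e assume "e \<in> range (\<lambda>j. {rim j, rim (j + 1)})"
      then obtain j where "e = {rim j, rim (j + 1)}" by blast
      then show "e \<in> (\<lambda>i. {rim (int i), rim (int i + 1)}) ` {..<2 * n}"
        using red[of j] by auto
    qed auto
    show "range (\<lambda>j. {rim j, apex (sg j)}) = (\<lambda>i. {rim (int i), apex (sg (int i))}) ` {..<2 * n}"
    proof (intro equalityI subsetI)
      fix e assume "e \<in> range (\<lambda>j. {rim j, apex (sg j)})"
      then obtain j where "e = {rim j, apex (sg j)}" by blast
      then show "e \<in> (\<lambda>i. {rim (int i), apex (sg (int i))}) ` {..<2 * n}"
        using red[of j] by auto
    qed auto
  qed
  show ?thesis
    unfolding skeleton_edges_solid 1 2 edges_def image_Un image_image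
    by (intro arg_cong2[where f = "(\<union>)"] image_cong) (auto simp: place_succ place_pole place_rim)
qed

lemma polyhedral_graph_edges: "polyhedral_graph verts edges"
proof -
  have "card e = 2" if "e \<in> edges" for e
    using that succ_neq[symmetric] by (auto simp: edges_def pole_def card_insert_if)
  then have "simple_graph verts edges"
    using edges_subset by (auto simp: simple_graph_def verts_def)
  moreover have "{u, v} \<in> edges \<longleftrightarrow> {place u, place v} \<in> skeleton_edges solid"
    if "u \<in> verts" "v \<in> verts" for u v
  proof -
    \<comment> \<open>Injectivity of \<open>place\<close> on vertices lifts to sets of vertices, so
      non-edges also map to non-edges.\<close>
    have "{u, v} \<in> edges \<longleftrightarrow> place ` {u, v} \<in> (`) place ` edges"
      by (rule inj_on_image_mem_iff[OF inj_on_image_Pow[OF inj_on_place], symmetric])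
        (use that edges_subset in auto)
    then show ?thesis by (simp add: place_edges)
  qed
  moreover have "bij_betw place verts (skeleton_vertices solid)"
    by (simp add: bij_betw_def inj_on_place place_verts skeleton_vertices_solid)
  ultimately show ?thesis
    using polytope_solid aff_dim_solid
    unfolding polyhedral_graph_def graph_isomorphic_def by blast
qed

text \<open>Two rim edges could coincide only if \<open>succ\<close> applied twice were the identity
  somewhere, but the rim cycle is too long; apex edges differ by containing a number from
  \<open>2 * n\<close> on.\<close>

lemma card_edges: "card edges = 4 * n"
proof -
  have "inj_on (\<lambda>i. {i, succ i}) {..<2 * n}"
    using n_ge_3 by (auto simp: inj_on_def doubleton_eq_iff succ_def split: if_splits)
  moreover have "inj_on (\<lambda>i. {i, pole i}) {..<2 * n}"
    by (auto simp: inj_on_def doubleton_eq_iff pole_def)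
  moreover have "(\<lambda>i. {i, succ i}) ` {..<2 * n} \<inter> (\<lambda>i. {i, pole i}) ` {..<2 * n} = {}"
    using succ_lt by (force simp: doubleton_eq_iff pole_def split: if_splits)
  ultimately show ?thesis
    unfolding edges_def by (simp add: card_Un_disjoint card_image)
qed

section \<open>The colour classes\<close>

text \<open>The names refer to the rim; each apex joins the class of the opposite parity, because
  \<open>pole\<close> links it to rim vertices of its own parity.\<close>

definition evens :: "nat set" where
  "evens = insert (2 * n + 1) ((\<lambda>i. 2 * i) ` {..<n})"

definition odds :: "nat set" where
  "odds = insert (2 * n) ((\<lambda>i. 2 * i + 1) ` {..<n})"

lemma evens_iff: "i \<in> evens \<longleftrightarrow> i < 2 * n \<and> even i \<or> i = 2 * n + 1"
  by (auto simp: evens_def elim!: evenE)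

lemma odds_iff: "i \<in> odds \<longleftrightarrow> i < 2 * n \<and> odd i \<or> i = 2 * n"
  by (auto simp: odds_def elim!: oddE)

lemma bipartition_edges: "bipartition verts edges evens odds"
  unfolding bipartition_def
proof (intro conjI ballI)
  show "evens \<union> odds = verts"
    by (auto simp: evens_iff odds_iff verts_split)
  show "evens \<inter> odds = {}"
    by (auto simp: evens_iff odds_iff)
  fix e assume "e \<in> edges"
  then obtain i j where i: "i < 2 * n" and e: "e = {i, j}" and j: "j = succ i \<or> j = pole i"
    by (auto simp: edges_def)
  \<comment> \<open>Parity also flips at the wrap-around, from \<open>2 * n - 1\<close> to
    \<open>0\<close>.\<close>
  have "even (succ i) \<longleftrightarrow> odd i"
    using n_ge_3 by (auto simp: succ_def)
  then have "i \<in> evens \<and> j \<in> odds \<or> i \<in> odds \<and> j \<in> evens"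
    using i j succ_lt[OF i] by (auto simp: evens_iff odds_iff pole_def)
  then show "\<exists>a\<in>evens. \<exists>b\<in>odds. e = {a, b}"
    using e by blast
qed

lemma card_evens: "card evens = n + 1" and card_odds: "card odds = n + 1"
proof -
  have "2 * n + 1 \<notin> (\<lambda>i. 2 * i) ` {..<n}" "2 * n \<notin> (\<lambda>i. 2 * i + 1) ` {..<n}"
    by auto
  then show "card evens = n + 1" "card odds = n + 1"
    by (simp_all add: evens_def odds_def card_image inj_on_def)
qed

end

theorem proposition5p3:
  fixes k :: nat
  assumes "k \<ge> 4"
  shows "\<exists>(V :: nat set) E A B. polyhedral_graph V E \<and> bipartition V E A B \<and>
           card A = k \<and> card B = k \<and> card E = 4 * k - 4"
proof -
  \<comment> \<open>Each class has \<open>n + 1\<close> vertices, whence \<open>n = k - 1\<close>;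
    the bound on \<open>k\<close> gives \<open>n\<close> at least 3.\<close>
  interpret trapezohedron "k - 1"
    using assms by unfold_locales simp
  have "card evens = k" "card odds = k" "card edges = 4 * k - 4"
    using card_evens card_odds card_edges assms by simp_all
  then show ?thesis
    using polyhedral_graph_edges bipartition_edges by blast
qed

end
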